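(* Let $G$ be a graph of order $n$ and size $m$ with $\delta(G)\geq 1$, having $e$ end-vertices, $p$ penultimate vertices, and non-increasing degree sequence $d_1\geq\cdots\geq d_n$. Then $$\gamma_{\times2}(G)\geq s\ell_{\times2}(G)\geq\frac{4n-2m+e-p}{3}.$$ Furthermore, $s\ell_{\times2}(G)=(4n-2m+e-p)/3$ if and only if $n+m+e-p\equiv 0\pmod 3$ and the following hold: (i) if $\delta(G)\geq 2$, then $d_q=2$, where $q=(4n-2m+3)/3$; (ii) if $\delta(G)=1$, then either $n=2m-e+p$, or ($n<2m-e+p$ and $d_q=2$, where $q=(4n-2m-2e-p+3)/3$).
   Context: An end-vertex is a vertex of degree one; a penultimate vertex is a vertex adjacent to an end-vertex. A double dominating set is a set $S\subseteq V(G)$ with $|N[v]\cap S|\geq2$ for all $v\in V(G)$ ($N[v]$ the closed neighborhood); $\gamma_{\times2}(G)$ is the minimum size of such a set. The double Slater number is $s\ell_{\times2}(G)=\min\{t\mid t+d_1+\cdots+d_{t-e}\geq 2n-p\}$. *)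

theory Defs
  imports Complex_Main "HOL-Library.Multiset" "HOL-Number_Theory.Cong"
begin

locale simple_graph =
  fixes V :: "'a set" and E :: "'a set set"
  assumes finite_V: "finite V"
    and V_nonempty: "V \<noteq> {}"
    and edges: "\<And>f. f \<in> E \<Longrightarrow> f \<subseteq> V \<and> card f = 2"

definition neighborhood :: "'a set set \<Rightarrow> 'a \<Rightarrow> 'a set" where
  "neighborhood E v = {u. {u, v} \<in> E}"

definition closed_neighborhood :: "'a set set \<Rightarrow> 'a \<Rightarrow> 'a set" where
  "closed_neighborhood E v = insert v (neighborhood E v)"

definition degree :: "'a set set \<Rightarrow> 'a \<Rightarrow> nat" where
  "degree E v = card (neighborhood E v)"

definition min_degree :: "'a set \<Rightarrow> 'a set set \<Rightarrow> nat" where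
  "min_degree V E = Min (degree E ` V)"

definition end_vertices :: "'a set \<Rightarrow> 'a set set \<Rightarrow> 'a set" where
  "end_vertices V E = {v \<in> V. degree E v = 1}"

definition penultimate_vertices :: "'a set \<Rightarrow> 'a set set \<Rightarrow> 'a set" where
  "penultimate_vertices V E = {v \<in> V. \<exists>u \<in> end_vertices V E. u \<in> neighborhood E v}"

text \<open>The non-increasing list of vertex degrees; \<open>d\<^sub>i\<close> is its entry at (0-based) position \<open>i - 1\<close>.\<close>

definition degree_sequence :: "'a set \<Rightarrow> 'a set set \<Rightarrow> nat list" where
  "degree_sequence V E = rev (sorted_list_of_multiset (image_mset (degree E) (mset_set V)))"

definition double_dominating_set :: "'a set \<Rightarrow> 'a set set \<Rightarrow> 'a set \<Rightarrow> bool" where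
  "double_dominating_set V E S \<longleftrightarrow>
     S \<subseteq> V \<and> (\<forall>v \<in> V. card (closed_neighborhood E v \<inter> S) \<ge> 2)"

definition double_domination_number :: "'a set \<Rightarrow> 'a set set \<Rightarrow> nat" where
  "double_domination_number V E = (LEAST k. \<exists>S. double_dominating_set V E S \<and> card S = k)"

text \<open>The truncated subtractions are harmless: the number \<open>e\<close> of end-vertices and the number \<open>p\<close> of
  penultimate vertices are at most the order \<open>n\<close>, so \<open>2 n - p \<ge> n \<ge> e\<close>, and a \<open>t < e\<close> (where the
  degree sum is empty) never qualifies.\<close>

definition double_slater_number :: "'a set \<Rightarrow> 'a set set \<Rightarrow> nat" where
  "double_slater_number V E =
     (LEAST t. t + sum_list (take (t - card (end_vertices V E)) (degree_sequence V E))
               \<ge> 2 * card V - card (penultimate_vertices V E))"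

end

theory Submission
  imports Defs
begin

text \<open>Double counting the pairs \<open>(v, u)\<close> with \<open>v \<in> V\<close>, \<open>u \<in> N[v] \<inter> S\<close> bounds a double dominating
  set \<open>S\<close>: it contains every end-vertex and every penultimate vertex, so a penultimate vertex with
  \<open>k\<close> end-neighbours is dominated at least \<open>k + 1\<close> times, an excess of at least \<open>k - 1\<close> over the
  required \<open>2\<close>; the numbers \<open>k - 1\<close> sum to \<open>e - p\<close>. For the numerical bound, exactly the last \<open>e\<close> terms of the degree sequence
  are \<open>1\<close> and the first \<open>n - e\<close> are at least \<open>2\<close>, so the sum of the first \<open>t - e\<close> degrees is at most
  \<open>2 m - e - 2 (n - t)\<close>, with equality iff \<open>d\<^sub>i = 2\<close> for \<open>t - e < i \<le> n - e\<close>.\<close>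

section \<open>Sums over non-increasing lists of natural numbers\<close>

text \<open>An exchange argument along the list: each head pays for one element of \<open>M\<close>.
  It is applied to the degrees of the vertices of a double dominating set that are not
  end-vertices.\<close>

lemma sum_mset_le_sum_list_take:
  fixes xs :: "nat list"
  assumes "sorted_wrt (\<ge>) xs" and "M \<subseteq># mset xs"
  shows "sum_mset M \<le> sum_list (take (size M) xs)"
  using assms
proof (induction xs arbitrary: M)
  case Nil
  then show ?case by simp
next
  case (Cons x xs)
  show ?case
  proof (cases "M = {#}")
    case True
    then show ?thesis by simp
  next
    case False
    \<comment> \<open>If \<open>x\<close> occurs in \<open>M\<close>, it has to be the element
      removed, so that the rest fits into \<open>xs\<close>. Otherwise \<open>M\<close> already fits
      into \<open>xs\<close>, and any element will do, as all are at most \<open>x\<close>.\<close>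
    define y where "y = (if x \<in># M then x else (SOME y. y \<in># M))"
    have "\<exists>y. y \<in># M" using False by auto
    then have yM: "y \<in># M" unfolding y_def by (auto intro: someI_ex)
    then have "y \<in># mset (x # xs)" using Cons.prems(2) by (rule mset_subset_eqD[rotated])
    then have yx: "y \<le> x" using Cons.prems(1) by auto
    have "M - {#x#} \<subseteq># mset xs" using Cons.prems(2) by (simp add: subset_eq_diff_conv)
    then have sub: "M - {#y#} \<subseteq># mset xs"
      by (cases "x \<in># M")
        (auto simp: y_def diff_single_trivial intro: subset_mset.order_trans[OF diff_subset_eq_self])
    have M: "M = add_mset y (M - {#y#})" using yM by simp
    have "sum_mset (M - {#y#}) \<le> sum_list (take (size (M - {#y#})) xs)"
      using Cons.IH[OF _ sub] Cons.prems(1) by simp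
    then have "sum_mset (add_mset y (M - {#y#}))
        \<le> sum_list (take (size (add_mset y (M - {#y#}))) (x # xs))"
      using yx by simp
    then show ?thesis using M by simp
  qed
qed

text \<open>Once an entry drops below 2 it is 1, and so are all later ones. In a degree sequence the
  tail of ones belongs to the end-vertices.\<close>

lemma sorted_desc_split_ones:
  fixes xs :: "nat list"
  assumes "sorted_wrt (\<ge>) xs" and "\<forall>x \<in> set xs. x \<ge> 1"
  shows "xs = filter (\<lambda>x. 2 \<le> x) xs @ replicate (count_list xs 1) 1"
  using assms
proof (induction xs)
  case Nil
  then show ?case by simp
next
  case (Cons x xs)
  show ?case
  proof (cases "2 \<le> x")
    case True
    then show ?thesis using Cons by simp
  next
    case False
    then have "x = 1" using Cons.prems by force
    moreover from this have "\<forall>y \<in> set xs. y = 1" using Cons.prems by force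
    moreover from this have "filter (\<lambda>x. 2 \<le> x) xs = []" by (force simp: filter_empty_conv)
    ultimately show ?thesis using Cons by simp
  qed
qed

lemma sum_list_ge_twice_length:
  fixes xs :: "nat list"
  assumes "\<forall>x \<in> set xs. 2 \<le> x"
  shows "2 * length xs \<le> sum_list xs"
  using assms by (induction xs) auto

lemma sum_list_eq_twice_length_iff:
  fixes xs :: "nat list"
  assumes "\<forall>x \<in> set xs. 2 \<le> x"
  shows "sum_list xs = 2 * length xs \<longleftrightarrow> (\<forall>x \<in> set xs. x = 2)"
  using assms
proof (induction xs)
  case Nil
  then show ?case by simp
next
  case (Cons x xs)
  then show ?case using sum_list_ge_twice_length[of xs] by auto
qed

section \<open>Incidence counts in a simple graph\<close>

context simple_graph
begin

lemma finite_E: "finite E"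
proof (rule finite_subset)
  show "E \<subseteq> Pow V" using edges by blast
qed (simp add: finite_V)

lemma neighborhood_subset: "neighborhood E v \<subseteq> V"
  using edges by (auto simp: neighborhood_def)

lemma finite_neighborhood: "finite (neighborhood E v)"
  using neighborhood_subset finite_V finite_subset by blast

lemma not_self_neighbor: "v \<notin> neighborhood E v"
  using edges[of "{v}"] by (auto simp: neighborhood_def)

lemma neighborhood_commute: "u \<in> neighborhood E v \<longleftrightarrow> v \<in> neighborhood E u"
  by (simp add: neighborhood_def insert_commute)

lemma closed_neighborhood_commute:
  "u \<in> closed_neighborhood E v \<longleftrightarrow> v \<in> closed_neighborhood E u"
  using neighborhood_commute by (auto simp: closed_neighborhood_def)

lemma card_closed_neighborhood: "card (closed_neighborhood E v) = Suc (degree E v)"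
  using not_self_neighbor finite_neighborhood
  by (simp add: closed_neighborhood_def degree_def)

lemma finite_closed_neighborhood: "finite (closed_neighborhood E v)"
  using finite_neighborhood by (simp add: closed_neighborhood_def)

lemma degree_eq_card_incident: "degree E v = card {f \<in> E. v \<in> f}"
proof -
  have "bij_betw (\<lambda>u. {u, v}) (neighborhood E v) {f \<in> E. v \<in> f}"
  proof (rule bij_betwI')
    fix x y
    show "({x, v} = {y, v}) = (x = y)" by (auto simp: doubleton_eq_iff)
  next
    fix x assume "x \<in> neighborhood E v"
    then show "{x, v} \<in> {f \<in> E. v \<in> f}" by (simp add: neighborhood_def)
  next
    fix f assume f: "f \<in> {f \<in> E. v \<in> f}"
    then have "card f = 2" using edges by blast
    then obtain u where "f = {u, v}" using f by (auto simp: card_2_iff)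
    then show "\<exists>x \<in> neighborhood E v. f = {x, v}" using f by (auto simp: neighborhood_def)
  qed
  then show ?thesis unfolding degree_def by (rule bij_betw_same_card)
qed

lemma sum_degree: "(\<Sum>v \<in> V. degree E v) = 2 * card E"
proof -
  have "(\<Sum>v \<in> V. card {f \<in> E. v \<in> f}) = (\<Sum>f \<in> E. 2)"
  proof (rule sum_multicount_gen[OF finite_V finite_E], intro ballI)
    fix f assume "f \<in> E"
    then have "{v \<in> V. v \<in> f} = f" "card f = 2" using edges by auto
    then show "card {v \<in> V. v \<in> f} = 2" by simp
  qed
  then show ?thesis by (simp add: degree_eq_card_incident)
qed

text \<open>Counted from the other side, each \<open>u\<close> in \<open>S\<close> lies in the
  closed neighborhoods of exactly \<open>degree E u + 1\<close> vertices.\<close>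

lemma sum_card_closed_neighborhood_Int:
  assumes "S \<subseteq> V"
  shows "(\<Sum>v \<in> V. card (closed_neighborhood E v \<inter> S)) = card S + (\<Sum>u \<in> S. degree E u)"
proof -
  have fS: "finite S" using assms finite_V finite_subset by blast
  have "(\<Sum>v \<in> V. card {u \<in> S. u \<in> closed_neighborhood E v}) = (\<Sum>u \<in> S. Suc (degree E u))"
  proof (rule sum_multicount_gen[OF finite_V fS], intro ballI)
    fix u assume "u \<in> S"
    then have "{v \<in> V. u \<in> closed_neighborhood E v} = closed_neighborhood E u"
      using assms neighborhood_subset[of u] closed_neighborhood_commute[of u]
      by (auto simp: closed_neighborhood_def)
    then show "card {v \<in> V. u \<in> closed_neighborhood E v} = Suc (degree E u)"
      by (simp add: card_closed_neighborhood)
  qed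
  moreover have "closed_neighborhood E v \<inter> S = {u \<in> S. u \<in> closed_neighborhood E v}" for v
    by auto
  ultimately show ?thesis by (simp add: sum_Suc)
qed

text \<open>Every end-vertex has a single neighbor, hence is counted once.\<close>

lemma sum_card_end_neighbors:
  "(\<Sum>v \<in> V. card (neighborhood E v \<inter> end_vertices V E)) = card (end_vertices V E)"
proof -
  have fe: "finite (end_vertices V E)" using finite_V by (simp add: end_vertices_def)
  have "(\<Sum>v \<in> V. card {u \<in> end_vertices V E. u \<in> neighborhood E v})
      = (\<Sum>u \<in> end_vertices V E. 1)"
  proof (rule sum_multicount_gen[OF finite_V fe], intro ballI)
    fix u assume u: "u \<in> end_vertices V E"
    have "{v \<in> V. u \<in> neighborhood E v} = neighborhood E u"
      using neighborhood_subset[of u] neighborhood_commute[of u] by auto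
    then show "card {v \<in> V. u \<in> neighborhood E v} = 1"
      using u by (simp add: end_vertices_def degree_def)
  qed
  moreover have "neighborhood E v \<inter> end_vertices V E
      = {u \<in> end_vertices V E. u \<in> neighborhood E v}" for v
    by auto
  ultimately show ?thesis by simp
qed

section \<open>Double dominating sets and the degree sequence\<close>

text \<open>The closed neighborhood of an end-vertex has only two elements, so double domination
  needs both. This forces all end-vertices and all penultimate vertices into
  \<open>S\<close>.\<close>

lemma closed_neighborhood_end_vertex_subset:
  assumes "double_dominating_set V E S" and "u \<in> end_vertices V E"
  shows "closed_neighborhood E u \<subseteq> S"
proof -
  have "card (closed_neighborhood E u \<inter> S) \<ge> card (closed_neighborhood E u)"
    using assms
    by (simp add: double_dominating_set_def end_vertices_def card_closed_neighborhood numeral_2_eq_2)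
  then have "closed_neighborhood E u \<inter> S = closed_neighborhood E u"
    by (intro card_seteq finite_closed_neighborhood) auto
  then show ?thesis by blast
qed

text \<open>Summing \<open>pt\<close> over \<open>V\<close> gives an extra \<open>card ?L\<close> on
  the left. It cancels against the degrees of the end-vertices, all of which lie in
  \<open>S\<close>, leaving only the degrees over the rest of \<open>S\<close>.\<close>

lemma double_dominating_set_degree_sum:
  assumes S: "double_dominating_set V E S"
  shows "2 * card V \<le> card S + (\<Sum>u \<in> S - end_vertices V E. degree E u)
    + card (penultimate_vertices V E)"
proof -
  let ?L = "end_vertices V E" and ?P = "penultimate_vertices V E"
  have SV: "S \<subseteq> V" using S by (simp add: double_dominating_set_def)
  then have fS: "finite S" using finite_V finite_subset by blast
  have LS: "?L \<subseteq> S"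
    using closed_neighborhood_end_vertex_subset[OF S] by (auto simp: closed_neighborhood_def)
  have PV: "?P \<subseteq> V" by (auto simp: penultimate_vertices_def)
  \<comment> \<open>The indicator of \<open>?P\<close> on the right replaces the excess
    \<open>k - 1\<close>, so that one inequality without subtraction also covers the vertices with
    \<open>k = 0\<close>.\<close>
  have pt: "2 + card (neighborhood E v \<inter> ?L)
      \<le> card (closed_neighborhood E v \<inter> S) + (if v \<in> ?P then 1 else 0)" if v: "v \<in> V" for v
  proof (cases "v \<in> ?P")
    case True
    then obtain u where "u \<in> ?L" "u \<in> neighborhood E v" by (auto simp: penultimate_vertices_def)
    then have "v \<in> S"
      using closed_neighborhood_end_vertex_subset[OF S, of u] neighborhood_commute[of u v]
      by (auto simp: closed_neighborhood_def)
    then have "insert v (neighborhood E v \<inter> ?L) \<subseteq> closed_neighborhood E v \<inter> S"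
      using LS by (auto simp: closed_neighborhood_def)
    then have "card (insert v (neighborhood E v \<inter> ?L)) \<le> card (closed_neighborhood E v \<inter> S)"
      using finite_closed_neighborhood by (intro card_mono) auto
    then show ?thesis using True not_self_neighbor finite_neighborhood by simp
  next
    case False
    then have "neighborhood E v \<inter> ?L = {}" using v by (auto simp: penultimate_vertices_def)
    then show ?thesis using S v False by (simp add: double_dominating_set_def)
  qed
  have "(\<Sum>v \<in> V. 2 + card (neighborhood E v \<inter> ?L))
      \<le> (\<Sum>v \<in> V. card (closed_neighborhood E v \<inter> S) + (if v \<in> ?P then 1 else 0))"
    by (rule sum_mono) (rule pt)
  moreover have "(\<Sum>v \<in> V. if v \<in> ?P then 1 else 0) = card ?P"
    using PV finite_V by (simp add: sum.If_cases Int_absorb1)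
  ultimately have "2 * card V + card ?L \<le> card S + (\<Sum>u \<in> S. degree E u) + card ?P"
    unfolding sum.distrib by (simp add: sum_card_end_neighbors sum_card_closed_neighborhood_Int[OF SV])
  moreover have "(\<Sum>u \<in> S. degree E u) = (\<Sum>u \<in> S - ?L. degree E u) + (\<Sum>u \<in> ?L. degree E u)"
    using sum.subset_diff[OF LS fS] by blast
  moreover have "(\<Sum>u \<in> ?L. degree E u) = card ?L" by (simp add: end_vertices_def)
  ultimately show ?thesis by linarith
qed

lemma mset_degree_sequence:
  "mset (degree_sequence V E) = image_mset (degree E) (mset_set V)"
  by (simp add: degree_sequence_def)

lemma sorted_degree_sequence: "sorted_wrt (\<ge>) (degree_sequence V E)"
  by (simp add: degree_sequence_def sorted_wrt_rev)

lemma length_degree_sequence: "length (degree_sequence V E) = card V"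
  by (metis mset_degree_sequence size_image_mset size_mset size_mset_set)

lemma sum_list_degree_sequence: "sum_list (degree_sequence V E) = 2 * card E"
  by (metis mset_degree_sequence sum_degree sum_mset_sum_list sum_unfold_sum_mset)

lemma set_degree_sequence: "set (degree_sequence V E) = degree E ` V"
  by (metis mset_degree_sequence finite_V finite_set_mset_mset_set set_image_mset set_mset_mset)

lemma count_list_degree_sequence:
  "count_list (degree_sequence V E) 1 = card (end_vertices V E)"
proof -
  have "count_list (degree_sequence V E) 1 = count (image_mset (degree E) (mset_set V)) 1"
    by (metis mset_degree_sequence count_mset)
  also have "\<dots> = card (end_vertices V E)"
    using finite_V unfolding count_image_mset' end_vertices_def card_eq_sum
    by (intro sum.cong) auto
  finally show ?thesis .
qed

text \<open>\<open>card S\<close> thus meets the condition whose least solution is the double Slater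
  number: the vertices of \<open>S\<close> outside \<open>?L\<close> number
  \<open>card S - card ?L\<close>, and their degrees sum to at most that many of the largest
  ones.\<close>

lemma double_dominating_set_slater:
  assumes S: "double_dominating_set V E S"
  shows "2 * card V - card (penultimate_vertices V E)
    \<le> card S + sum_list (take (card S - card (end_vertices V E)) (degree_sequence V E))"
proof -
  let ?L = "end_vertices V E"
  have SV: "S \<subseteq> V" using S by (simp add: double_dominating_set_def)
  have LS: "?L \<subseteq> S"
    using closed_neighborhood_end_vertex_subset[OF S] by (auto simp: closed_neighborhood_def)
  have fL: "finite ?L" using finite_V by (simp add: end_vertices_def)
  have "mset_set (S - ?L) \<subseteq># mset_set V"
    using SV finite_V by (intro subset_imp_msubset_mset_set) auto
  then have "image_mset (degree E) (mset_set (S - ?L)) \<subseteq># mset (degree_sequence V E)"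
    unfolding mset_degree_sequence by (rule image_mset_subseteq_mono)
  from sum_mset_le_sum_list_take[OF sorted_degree_sequence this]
  have "(\<Sum>u \<in> S - ?L. degree E u)
      \<le> sum_list (take (card S - card ?L) (degree_sequence V E))"
    by (simp add: sum_unfold_sum_mset card_Diff_subset[OF fL LS])
  then show ?thesis using double_dominating_set_degree_sum[OF S] by linarith
qed

lemma degree_ge_1:
  assumes "min_degree V E \<ge> 1" and "v \<in> V"
  shows "degree E v \<ge> 1"
  using assms finite_V by (metis Min_le finite_imageI image_eqI min_degree_def order_trans)

text \<open>A witness that both minima are attained: it makes the domination number the size of an
  actual set, and it shows that \<open>t = n\<close> meets the Slater condition.\<close>

lemma double_dominating_set_V:
  assumes "min_degree V E \<ge> 1"
  shows "double_dominating_set V E V"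
  unfolding double_dominating_set_def
proof (intro conjI ballI)
  fix v assume v: "v \<in> V"
  then have "closed_neighborhood E v \<inter> V = closed_neighborhood E v"
    using neighborhood_subset by (auto simp: closed_neighborhood_def)
  then show "2 \<le> card (closed_neighborhood E v \<inter> V)"
    using degree_ge_1[OF assms v] by (simp add: card_closed_neighborhood)
qed simp

lemma slater_le_double_domination_number:
  assumes "min_degree V E \<ge> 1"
  shows "double_slater_number V E \<le> double_domination_number V E"
proof -
  have "\<exists>S. double_dominating_set V E S \<and> card S = double_domination_number V E"
    unfolding double_domination_number_def
    by (rule LeastI_ex) (use double_dominating_set_V[OF assms] in blast)
  then obtain S where "double_dominating_set V E S" "card S = double_domination_number V E"
    by blast
  then show ?thesis
    unfolding double_slater_number_def by (intro Least_le) (metis double_dominating_set_slater)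
qed

lemma end_vertices_empty:
  assumes "min_degree V E \<ge> 2"
  shows "end_vertices V E = {}"
proof -
  have "degree E v \<ge> 2" if "v \<in> V" for v
    using assms that finite_V by (metis Min_le finite_imageI image_eqI min_degree_def order_trans)
  then show ?thesis by (force simp: end_vertices_def)
qed

end

section \<open>The numerical bound and its equality case\<close>

text \<open>Asking for a natural \<open>q\<close> in \<open>{1..n}\<close> makes the fraction an
  integer and keeps the list access behind \<open>d q\<close> within range.\<close>

theorem theorem6:
  fixes V :: "'a set" and E :: "'a set set"
    and n m e p :: nat and d :: "nat \<Rightarrow> nat"
  assumes "simple_graph V E"
    and "min_degree V E \<ge> 1"
    and "n = card V"
    and "m = card E"
    and "e = card (end_vertices V E)"
    and "p = card (penultimate_vertices V E)"
    and "d = (\<lambda>i. degree_sequence V E ! (i - 1))"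
  shows "double_domination_number V E \<ge> double_slater_number V E
    \<and> real (double_slater_number V E) \<ge> (4 * real n - 2 * real m + real e - real p) / 3
    \<and> (real (double_slater_number V E) = (4 * real n - 2 * real m + real e - real p) / 3
       \<longleftrightarrow>
       [int n + int m + int e - int p = 0] (mod 3)
       \<and> (min_degree V E \<ge> 2 \<longrightarrow>
            (\<exists>q \<in> {1..n}. real q = (4 * real n - 2 * real m + 3) / 3 \<and> d q = 2))
       \<and> (min_degree V E = 1 \<longrightarrow>
            int n = 2 * int m - int e + int p
            \<or> (int n < 2 * int m - int e + int p
               \<and> (\<exists>q \<in> {1..n}. real q = (4 * real n - 2 * real m - 2 * real e - real p + 3) / 3
                               \<and> d q = 2))))"
proof -
  interpret simple_graph V E by fact
  define xs where "xs = degree_sequence V E"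
  define ys where "ys = filter (\<lambda>x. 2 \<le> x) xs"
  define t where "t = double_slater_number V E"
  have xs_split: "xs = ys @ replicate e 1"
    using sorted_desc_split_ones[OF sorted_degree_sequence] degree_ge_1[OF assms(2)]
    unfolding xs_def ys_def assms(5) count_list_degree_sequence[symmetric]
    by (simp add: set_degree_sequence)
  have ys2: "\<forall>x \<in> set ys. 2 \<le> x" by (simp add: ys_def)
  have len: "length ys + e = n"
    using length_degree_sequence xs_split assms(3) unfolding xs_def
    by (metis length_append length_replicate)
  have "sum_list xs = 2 * m" using sum_list_degree_sequence assms(4) by (simp add: xs_def)
  then have sum_ys: "sum_list ys + e = 2 * m" using xs_split by (simp add: sum_list_replicate)
  have "p \<le> n" using finite_V unfolding assms by (intro card_mono) (auto simp: penultimate_vertices_def)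
  have "n \<ge> 1" using finite_V V_nonempty assms(3) by (simp add: Suc_le_eq card_gt_0_iff)
  define Q where "Q s \<longleftrightarrow> 2 * n - p \<le> s + sum_list (take (s - e) xs)" for s
  have t_Least: "t = (LEAST s. Q s)"
    by (simp add: t_def double_slater_number_def Q_def assms xs_def)
  have Qn: "Q n"
    using double_dominating_set_slater[OF double_dominating_set_V[OF assms(2)]]
    by (simp add: Q_def assms xs_def)
  \<comment> \<open>Here \<open>s - e\<close> is at most \<open>n - e\<close>, the length of
    \<open>ys\<close>, so the trailing ones are never reached.\<close>
  have take_xs: "take (s - e) xs = take (s - e) ys" if "s \<le> n" for s
    using that len by (simp add: xs_split)
  have n_le: "n + e \<le> 2 * m + p"
    using Qn take_xs[of n] len[symmetric] sum_ys \<open>p \<le> n\<close> by (simp add: Q_def)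
  have Qt: "Q t" unfolding t_Least using Qn by (rule LeastI)
  have t_le: "t \<le> s" if "Q s" for s unfolding t_Least using that by (rule Least_le)
  have "t \<le> n" using t_le Qn by blast
  \<comment> \<open>For \<open>t < e\<close> the degree sum is empty, and \<open>Q t\<close> would
    give \<open>n \<le> 2 * n - p \<le> t < e \<le> n\<close>.\<close>
  have "e \<le> t"
    using Qt \<open>p \<le> n\<close> len by (cases "t < e") (auto simp: Q_def)
  have split: "sum_list (take (s - e) xs) + sum_list (drop (s - e) ys) + e = 2 * m"
    if "s \<le> n" for s
  proof -
    have "sum_list ys = sum_list (take (s - e) ys) + sum_list (drop (s - e) ys)"
      by (metis append_take_drop_id sum_list_append)
    then show ?thesis using take_xs[OF that] sum_ys by simp
  qed
  have drop2: "\<forall>x \<in> set (drop k ys). 2 \<le> x" for k using ys2 by (meson in_set_dropD)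
  have len_drop: "length (drop (s - e) ys) + s = n" if "e \<le> s" "s \<le> n" for s
    using that len by simp
  \<comment> \<open>The bound with denominator and subtractions cleared: the \<open>n - t\<close>
    entries of \<open>ys\<close> left out by \<open>Q t\<close> are each at least 2.\<close>
  have lower: "4 * n + e \<le> 3 * t + 2 * m + p"
    using Qt split[OF \<open>t \<le> n\<close>] sum_list_ge_twice_length[OF drop2, of "t - e"]
      len_drop[OF \<open>e \<le> t\<close> \<open>t \<le> n\<close>] \<open>p \<le> n\<close>
    unfolding Q_def by linarith
  have eq_real: "real t = (4 * real n - 2 * real m + real e - real p) / 3
      \<longleftrightarrow> 3 * t + 2 * m + p = 4 * n + e"
    by (simp add: field_simps) linarith
  have d_nth: "d q = xs ! (q - 1)" for q by (simp add: assms xs_def)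
  \<comment> \<open>Equality makes every omitted entry of \<open>ys\<close> equal to 2. As
    \<open>t < n\<close> there is at least one, and the first has 1-based position
    \<open>t - e + 1\<close>.\<close>
  have eq_imp_d: "d (t - e + 1) = 2 \<and> t - e + 1 \<le> n"
    if eq: "3 * t + 2 * m + p = 4 * n + e" and "t < n"
  proof -
    have "sum_list (drop (t - e) ys) = 2 * length (drop (t - e) ys)"
      using Qt split[OF \<open>t \<le> n\<close>] sum_list_ge_twice_length[OF drop2, of "t - e"]
        len_drop[OF \<open>e \<le> t\<close> \<open>t \<le> n\<close>] \<open>p \<le> n\<close> eq
      unfolding Q_def by linarith
    then have "\<forall>x \<in> set (drop (t - e) ys). x = 2"
      using sum_list_eq_twice_length_iff[OF drop2] by blast
    moreover have lt: "t - e < length ys" using \<open>t < n\<close> \<open>e \<le> t\<close> len by linarith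
    ultimately have "ys ! (t - e) = 2"
      by (metis Cons_nth_drop_Suc list.set_intros(1))
    then show ?thesis using lt len by (simp add: d_nth xs_split nth_append)
  qed
  have d_imp_eq: "3 * t + 2 * m + p = 4 * n + e"
    if q: "q \<in> {1..n}" "d q = 2" and eq: "3 * (q + e) + 2 * m + p = 4 * n + e + 3" for q
  proof -
    \<comment> \<open>The candidate for \<open>t\<close>, obtained by solving
      \<open>q = s - e + 1\<close>.\<close>
    define s where "s = q + e - 1"
    have qs: "q - 1 = s - e" "e \<le> s" using q by (auto simp: s_def)
    have "q - 1 < length ys"
    proof (rule ccontr)
      assume "\<not> q - 1 < length ys"
      moreover have "q - 1 < n" using q by auto
      ultimately have "d q = 1" using len by (simp add: d_nth xs_split nth_append)
      then show False using q by simp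
    qed
    then have "s \<le> n" using qs len by linarith
    \<comment> \<open>From position \<open>q\<close> on, monotonicity bounds the entries of
      \<open>ys\<close> above by \<open>d q = 2\<close>, and membership in \<open>ys\<close> bounds
      them below by 2.\<close>
    have "x = 2" if x: "x \<in> set (drop (s - e) ys)" for x
    proof -
      obtain i where i: "i < length ys - (s - e)" "x = ys ! (s - e + i)"
        using x by (auto simp: in_set_conv_nth)
      have "xs ! (s - e + i) \<le> xs ! (s - e)"
        using sorted_wrt_nth_less[OF sorted_degree_sequence, of "s - e" "s - e + i"] i
        by (cases "i = 0") (auto simp: xs_def[symmetric] xs_split)
      moreover have "xs ! (s - e) = 2" using q(2) unfolding d_nth qs(1) .
      moreover have "s - e + i < length ys" using i(1) by linarith
      then have "x = xs ! (s - e + i)" using i(2) by (simp only: xs_split nth_append if_True)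
      ultimately have "x \<le> 2" by simp
      then show ?thesis using drop2 x by force
    qed
    then have "sum_list (drop (s - e) ys) = 2 * length (drop (s - e) ys)"
      using sum_list_eq_twice_length_iff[OF drop2] by blast
    moreover have s3: "3 * s + 2 * m + p = 4 * n + e" using eq q by (auto simp: s_def)
    ultimately have "Q s"
      using split[OF \<open>s \<le> n\<close>] len_drop[OF qs(2) \<open>s \<le> n\<close>] unfolding Q_def by linarith
    \<comment> \<open>Minimality gives \<open>t \<le> s\<close>, and \<open>lower\<close> together
      with \<open>s3\<close> gives \<open>s \<le> t\<close>.\<close>
    then show ?thesis using t_le[of s] lower s3 by linarith
  qed
  \<comment> \<open>With both counts zero, the index in (i) becomes the one in (ii), so
    \<open>d_imp_eq\<close> serves both cases.\<close>
  have e_p_0: "e = 0 \<and> p = 0" if "min_degree V E \<ge> 2"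
    using end_vertices_empty[OF that] by (simp add: assms penultimate_vertices_def)
  have key: "3 * t + 2 * m + p = 4 * n + e \<longleftrightarrow>
       [int n + int m + int e - int p = 0] (mod 3)
       \<and> (min_degree V E \<ge> 2 \<longrightarrow>
            (\<exists>q \<in> {1..n}. real q = (4 * real n - 2 * real m + 3) / 3 \<and> d q = 2))
       \<and> (min_degree V E = 1 \<longrightarrow>
            int n = 2 * int m - int e + int p
            \<or> (int n < 2 * int m - int e + int p
               \<and> (\<exists>q \<in> {1..n}. real q = (4 * real n - 2 * real m - 2 * real e - real p + 3) / 3
                               \<and> d q = 2)))" (is "?L \<longleftrightarrow> ?C \<and> (_ \<longrightarrow> ?I) \<and> (_ \<longrightarrow> ?J)")
  proof (intro iffI conjI impI)
    assume L: ?L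
    then have "int n + int m + int e - int p = 3 * (int t + int m - int n)"
      by (simp add: algebra_simps flip: of_nat_eq_iff[where 'a = int])
    then show ?C unfolding cong_0_iff by (rule dvdI)
  next
    assume L: ?L and "min_degree V E \<ge> 2"
    then have ep: "e = 0" "p = 0" using e_p_0 by auto
    \<comment> \<open>This excludes \<open>t = n\<close>: equality now reads
      \<open>3 * t = 4 * n - 2 * m\<close>, which is at most \<open>2 * n\<close>.\<close>
    have "2 * n \<le> 2 * m"
      using sum_list_ge_twice_length[OF ys2] sum_ys len ep by simp
    then have "t < n" using L ep \<open>n \<ge> 1\<close> by linarith
    moreover have "real (t + 1) = (4 * real n - 2 * real m + 3) / 3"
      using L ep by (simp add: field_simps)
    ultimately show ?I using eq_imp_d[OF L] ep by (intro bexI[of _ "t + 1"]) auto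
  next
    assume L: ?L
    show ?J
    \<comment> \<open>Under equality, \<open>t = n\<close> amounts to
      \<open>n = 2 * m - e + p\<close>, the first alternative of (ii). For \<open>t < n\<close> the
      index is \<open>q = t - e + 1\<close>.\<close>
    proof (cases "t < n")
      case True
      have "real (t - e + 1) = (4 * real n - 2 * real m - 2 * real e - real p + 3) / 3"
        using L \<open>e \<le> t\<close> by (simp add: field_simps of_nat_diff)
      moreover have "int n < 2 * int m - int e + int p" using L True by linarith
      ultimately show ?thesis using eq_imp_d[OF L True]
        by (intro disjI2 conjI bexI[of _ "t - e + 1"]) auto
    next
      case False
      then show ?thesis using L \<open>t \<le> n\<close> by (intro disjI1) linarith
    qed
  next
    assume R: "?C \<and> (min_degree V E \<ge> 2 \<longrightarrow> ?I) \<and> (min_degree V E = 1 \<longrightarrow> ?J)"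
    show ?L
    proof (cases "min_degree V E \<ge> 2")
      case True
      then obtain q where q: "q \<in> {1..n}" "d q = 2"
        "real q = (4 * real n - 2 * real m + 3) / 3" using R by blast
      have "3 * (q + e) + 2 * m + p = 4 * n + e + 3"
        using q(3) e_p_0[OF True] by (simp add: field_simps)
      then show ?thesis using d_imp_eq q by blast
    next
      case False
      then have ?J using R assms(2) by linarith
      then show ?thesis
      proof
        assume "int n = 2 * int m - int e + int p"
        \<comment> \<open>Here \<open>lower\<close> becomes \<open>n \<le> t\<close>, so
          \<open>t = n\<close> attains the bound.\<close>
        then show ?thesis using lower \<open>t \<le> n\<close> by linarith
      next
        assume "int n < 2 * int m - int e + int p
          \<and> (\<exists>q \<in> {1..n}. real q = (4 * real n - 2 * real m - 2 * real e - real p + 3) / 3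
                          \<and> d q = 2)"
        then obtain q where q: "q \<in> {1..n}" "d q = 2"
          "real q = (4 * real n - 2 * real m - 2 * real e - real p + 3) / 3" by blast
        have "3 * (q + e) + 2 * m + p = 4 * n + e + 3"
          using q(3) by (simp add: field_simps)
        then show ?thesis using d_imp_eq q by blast
      qed
    qed
  qed
  have "(4 * real n - 2 * real m + real e - real p) / 3 \<le> real t"
    using lower by (simp add: field_simps)
  then show ?thesis
    using slater_le_double_domination_number[OF assms(2)] key eq_real unfolding t_def by blast
qed

end
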